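(* Let $\lambda\in\mathbb{Z}^n$ be a composition. Then $Q_{\lambda/0}=Q_\lambda$, where $Q_{\lambda/0}$ denotes the skew function $Q_{\lambda/\mu}$ for the one-part composition $\mu=(0)$.
   Context: Let $x_1,x_2,\ldots$ be variables and define symmetric functions $q_n$ ($n\in\mathbb{Z}$) by $\prod_{i\ge1}\frac{1+zx_i}{1-zx_i}=\sum_{n\in\mathbb{Z}}q_nz^n$; so $q_0=1$ and $q_n=0$ for $n<0$. For $r,s\in\mathbb{Z}$ put $Q_{(r,s)}:=q_rq_s+2\sum_{i=1}^s(-1)^iq_{r+i}q_{s-i}$ (the sum is empty if $s<1$). A composition is a finite sequence of (possibly negative) integers. For a composition $\nu=(\nu_1,\ldots,\nu_N)$ let $M(\nu)$ be the $N\times N$ skew-symmetric matrix with $ij$-entry $Q_{(\nu_i,\nu_j)}$ if $i<j$, $0$ if $i=j$, and $-Q_{(\nu_j,\nu_i)}$ if $i>j$. For $\lambda\in\mathbb{Z}^n$ put $\lambda0:=(\lambda_1,\ldots,\lambda_n,0)$ and define $Q_\lambda:=\operatorname{Pf}M(\lambda)$ if $n$ is even and $Q_\lambda:=\operatorname{Pf}M(\lambda0)$ if $n$ is odd. Here $\operatorname{Pf}$ is the Pfaffian, normalized by $\operatorname{Pf}M=\sum_{j=2}^{2N}(-1)^jm_{1j}\operatorname{Pf}M_{1j}$, where $M_{1j}$ is $M$ with rows and columns $1,j$ deleted; the empty Pfaffian is $1$. For $\lambda\in\mathbb{Z}^n$, $\mu\in\mathbb{Z}^m$, let $N(\lambda,\mu)$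 be the $n\times m$ matrix with $(i,j)$ entry $q_{\lambda_i-\mu_{m+1-j}}$, and $M(\lambda,\mu):=\begin{pmatrix}M(\lambda)&N(\lambda,\mu)\\-N(\lambda,\mu)^t&0\end{pmatrix}$. The skew function is $Q_{\lambda/\mu}:=\operatorname{Pf}M(\lambda,\mu)$ if $n+m$ is even and $\operatorname{Pf}M(\lambda0,\mu)$ if $n+m$ is odd. *)

theory Defs
  imports
    "Jordan_Normal_Form.Determinant"
    "HOL-Library.Poly_Mapping"
    "HOL-Computational_Algebra.Formal_Power_Series"
begin

(* Formal power series in countably many variables: an arbitrary assignment of a coefficient
   to each monomial, monomials being finitely supported exponent vectors.  The ring of symmetric
   functions (symmetric series of bounded degree) is a subring. *)
typedef 'a mfps = "UNIV :: ((nat \<Rightarrow>\<^sub>0 nat) \<Rightarrow> 'a) set"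
  morphisms mcoeff Abs_mfps
  by simp

setup_lifting type_definition_mfps

lemma mfps_eqI: "(\<And>m. mcoeff f m = mcoeff g m) \<Longrightarrow> f = g"
  by (metis mcoeff_inject ext)

lemma mcoeff_Abs [simp]: "mcoeff (Abs_mfps f) = f"
  by (simp add: Abs_mfps_inverse)

lemma finite_monom_le: "finite {a :: nat \<Rightarrow>\<^sub>0 nat. \<exists>b. a + b = m}"
proof -
  let ?S = "{f. (\<forall>i\<in>Poly_Mapping.keys m. f i \<in> {..Poly_Mapping.lookup m i}) \<and> (\<forall>i. i \<notin> Poly_Mapping.keys m \<longrightarrow> f i = 0)}"
  have fin: "finite ?S"
  proof -
    let ?U = "(\<Union>i\<in>Poly_Mapping.keys m. {..Poly_Mapping.lookup m i})"
    have "finite {f. (\<forall>i. (i \<in> Poly_Mapping.keys m \<longrightarrow> f i \<in> ?U) \<and> (i \<notin> Poly_Mapping.keys m \<longrightarrow> f i = 0))}"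
      by (rule finite_set_of_finite_funs) auto
    then show ?thesis
      by (rule rev_finite_subset) auto
  qed
  have "Poly_Mapping.lookup ` {a. \<exists>b. a + b = m} \<subseteq> ?S"
    by (auto simp: lookup_add in_keys_iff)
  then have "finite (Poly_Mapping.lookup ` {a. \<exists>b. a + b = m})"
    using fin finite_subset by blast
  then show ?thesis
    by (rule finite_imageD) (auto intro: inj_onI poly_mapping_eqI)
qed

lemma finite_monom_split [simp]: "finite {(a, b). a + b = (m :: nat \<Rightarrow>\<^sub>0 nat)}"
proof -
  have "{(a, b). a + b = m} \<subseteq> {a. \<exists>b. a + b = m} \<times> {b. \<exists>a. b + a = m}"
    using add.commute by blast
  then show ?thesis
    using finite_monom_le finite_subset by blast
qed

instantiation mfps :: (comm_ring_1) comm_ring_1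
begin

lift_definition zero_mfps :: "'a mfps" is "\<lambda>m. 0" .
lift_definition one_mfps :: "'a mfps" is "\<lambda>m. if m = 0 then 1 else 0" .
lift_definition plus_mfps :: "'a mfps \<Rightarrow> 'a mfps \<Rightarrow> 'a mfps" is "\<lambda>f g m. f m + g m" .
lift_definition minus_mfps :: "'a mfps \<Rightarrow> 'a mfps \<Rightarrow> 'a mfps" is "\<lambda>f g m. f m - g m" .
lift_definition uminus_mfps :: "'a mfps \<Rightarrow> 'a mfps" is "\<lambda>f m. - f m" .
lift_definition times_mfps :: "'a mfps \<Rightarrow> 'a mfps \<Rightarrow> 'a mfps"
  is "\<lambda>f g m. \<Sum>(a, b)\<in>{(a, b). a + b = m}. f a * g b" .

instance
proof
  fix f g h :: "'a mfps"
  show "f * g = g * f"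
    by transfer (rule ext, rule sum.reindex_bij_witness[of _ prod.swap prod.swap],
        auto simp: add.commute mult.commute)
  show "(f * g) * h = f * (g * h)"
  proof (rule mfps_eqI)
    fix m
    let ?f = "mcoeff f" and ?g = "mcoeff g" and ?h = "mcoeff h"
    have "mcoeff ((f * g) * h) m =
        (\<Sum>p\<in>{(a, b). a + b = m}. \<Sum>r\<in>{(c, d). c + d = fst p}. ?f (fst r) * ?g (snd r) * ?h (snd p))"
      by (simp add: times_mfps.rep_eq case_prod_unfold sum_distrib_right)
    also have "\<dots> = (\<Sum>(p, r)\<in>(SIGMA p:{(a, b). a + b = m}. {(c, d). c + d = fst p}).
        ?f (fst r) * ?g (snd r) * ?h (snd p))"
      by (rule sum.Sigma) auto
    also have "\<dots> = (\<Sum>(p, r)\<in>(SIGMA p:{(a, b). a + b = m}. {(c, d). c + d = snd p}).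
        ?f (fst p) * (?g (fst r) * ?h (snd r)))"
      by (rule sum.reindex_bij_witness[of _
            "\<lambda>((a, bc), (b, c)). ((a + b, c), (a, b))" "\<lambda>((ab, c), (a, b)). ((a, b + c), (b, c))"])
         (auto simp: add.assoc mult.assoc)
    also have "\<dots> = (\<Sum>p\<in>{(a, b). a + b = m}. \<Sum>r\<in>{(c, d). c + d = snd p}. ?f (fst p) * (?g (fst r) * ?h (snd r)))"
      by (rule sum.Sigma[symmetric]) auto
    also have "\<dots> = mcoeff (f * (g * h)) m"
      by (simp add: times_mfps.rep_eq case_prod_unfold sum_distrib_left)
    finally show "mcoeff ((f * g) * h) m = mcoeff (f * (g * h)) m" .
  qed
  show "1 * f = f"
  proof (rule mfps_eqI)
    fix m
    have "mcoeff (1 * f) m = (\<Sum>p\<in>{(a, b). a + b = m}. if p = (0, m) then mcoeff f m else 0)"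
      unfolding times_mfps.rep_eq one_mfps.rep_eq
      by (rule sum.cong) (auto split: if_splits)
    then show "mcoeff (1 * f) m = mcoeff f m"
      by simp
  qed
  show "(f + g) * h = f * h + g * h"
    by (rule mfps_eqI)
       (simp add: times_mfps.rep_eq plus_mfps.rep_eq case_prod_unfold distrib_right sum.distrib)
  show "0 \<noteq> (1 :: 'a mfps)"
    by transfer (metis zero_neq_one)
qed (transfer; simp add: algebra_simps fun_eq_iff)+

end

(* The variables x_1, x_2, ... are indexed from 0. *)
definition mvar :: "nat \<Rightarrow> 'a::comm_ring_1 mfps" where
  "mvar i = Abs_mfps (\<lambda>m. if m = Poly_Mapping.single i 1 then 1 else 0)"

(* (1 + z x_i) / (1 - z x_i) as a power series in z; the second argument of fps_left_inverse is
   the inverse of the constant term. *)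
definition q_factor :: "nat \<Rightarrow> int mfps fps" where
  "q_factor i = (1 + fps_X * fps_const (mvar i)) *
     fps_left_inverse (1 - fps_X * fps_const (mvar i)) 1"

(* The infinite product is the coefficientwise limit of its finite subproducts. The limit is
   taken in the discrete space int; lemma q_partial_eventually shows that the coefficients are
   eventually constant. *)
definition schur_q :: "int \<Rightarrow> int mfps" where
  "schur_q n = (if n < 0 then 0
     else Abs_mfps (\<lambda>m. lim (\<lambda>k. mcoeff (fps_nth (\<Prod>i<k. q_factor i) (nat n)) m)))"

lemma q_factor_inverse:
  "fps_left_inverse (1 - fps_X * fps_const (mvar i :: int mfps)) 1 *
     (1 - fps_X * fps_const (mvar i)) = 1"
  by (rule fps_left_inverse) simp

lemma q_factor_eq:
  "q_factor i = 1 + fps_const (mvar i) *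
     (2 * fps_X * fps_left_inverse (1 - fps_X * fps_const (mvar i)) 1)"
proof -
  let ?I = "fps_left_inverse (1 - fps_X * fps_const (mvar i :: int mfps)) 1"
  have "q_factor i = ?I * (1 - fps_X * fps_const (mvar i)) + 2 * fps_X * fps_const (mvar i) * ?I"
    unfolding q_factor_def by (simp add: algebra_simps)
  then show ?thesis
    unfolding q_factor_inverse by (simp add: algebra_simps)
qed

lemma mcoeff_mvar_times:
  assumes "Poly_Mapping.lookup m i = 0"
  shows "mcoeff (mvar i * f) m = 0"
proof -
  have "a \<noteq> Poly_Mapping.single i 1" if "a + b = m" for a b
    using assms that by (auto simp: lookup_add)
  then show ?thesis
    unfolding times_mfps.rep_eq mvar_def by (intro sum.neutral) auto
qed

lemma q_partial_eventually:
  "\<exists>c. \<forall>\<^sub>F k in sequentially. mcoeff (fps_nth (\<Prod>i<k. q_factor i) n) m = c"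
proof -
  let ?c = "\<lambda>k. mcoeff (fps_nth (\<Prod>i<k. q_factor i) n) m"
  obtain K where "\<forall>i\<in>Poly_Mapping.keys m. i < K"
    using finite_nat_set_iff_bounded[of "Poly_Mapping.keys m"] finite_keys[of m] by blast
  then have K: "Poly_Mapping.lookup m i = 0" if "i \<ge> K" for i
    using that by (meson in_keys_iff not_le)
  have step: "?c (Suc k) = ?c k" if "k \<ge> K" for k
  proof -
    let ?P = "\<Prod>i<k. q_factor i"
    let ?R = "2 * fps_X * fps_left_inverse (1 - fps_X * fps_const (mvar k :: int mfps)) 1"
    have "(\<Prod>i<Suc k. q_factor i) = ?P + fps_const (mvar k) * (?P * ?R)"
      by (simp add: q_factor_eq algebra_simps)
    then have "?c (Suc k) = mcoeff (fps_nth ?P n + mvar k * fps_nth (?P * ?R) n) m"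
      by simp
    also have "\<dots> = ?c k"
      by (simp add: plus_mfps.rep_eq mcoeff_mvar_times K that)
    finally show ?thesis .
  qed
  have "?c k = ?c K" if "k \<ge> K" for k
    using that by (induction k rule: dec_induct) (simp_all add: step del: prod.lessThan_Suc)
  then show ?thesis
    unfolding eventually_sequentially by blast
qed

lemma schur_q_0: "schur_q 0 = 1"
proof -
  have "fps_nth (\<Prod>i<k. q_factor i) 0 = 1" for k
    by (induction k) (simp_all add: q_factor_eq)
  then show ?thesis
    by (simp add: schur_q_def mcoeff_inverse)
qed

definition Q_pair :: "int \<Rightarrow> int \<Rightarrow> int mfps" where
  "Q_pair r s = schur_q r * schur_q s +
     2 * (\<Sum>i\<in>{1..s}. (-1) ^ nat i * schur_q (r + i) * schur_q (s - i))"

(* Matrix indices start at 0, so the sign (-1)^j of the 1-based expansion becomes (-1)^(j+1). *)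
function pfaffian :: "'a::comm_ring_1 mat \<Rightarrow> 'a" where
  "pfaffian A = (if dim_row A = 0 then 1
     else \<Sum>j\<in>{1..<dim_row A}. (-1) ^ (j + 1) * A $$ (0, j) *
            pfaffian (mat_delete (mat_delete A j j) 0 0))"
  by pat_completeness auto
termination
  by (relation "measure dim_row") (auto simp: mat_delete_def)

declare pfaffian.simps [simp del]

definition Q_mat :: "int list \<Rightarrow> int mfps mat" where
  "Q_mat \<nu> = mat (length \<nu>) (length \<nu>) (\<lambda>(i, j).
     if i < j then Q_pair (\<nu> ! i) (\<nu> ! j)
     else if i = j then 0
     else - Q_pair (\<nu> ! j) (\<nu> ! i))"

definition Q_fun :: "int list \<Rightarrow> int mfps" where
  "Q_fun lam = (if even (length lam) then pfaffian (Q_mat lam) else pfaffian (Q_mat (lam @ [0])))"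

definition N_mat :: "int list \<Rightarrow> int list \<Rightarrow> int mfps mat" where
  "N_mat lam \<mu> = mat (length lam) (length \<mu>)
     (\<lambda>(i, j). schur_q (lam ! i - \<mu> ! (length \<mu> - 1 - j)))"

definition skew_mat :: "int list \<Rightarrow> int list \<Rightarrow> int mfps mat" where
  "skew_mat lam \<mu> = four_block_mat (Q_mat lam) (N_mat lam \<mu>)
     (- transpose_mat (N_mat lam \<mu>)) (0\<^sub>m (length \<mu>) (length \<mu>))"

definition Q_skew :: "int list \<Rightarrow> int list \<Rightarrow> int mfps" where
  "Q_skew lam \<mu> = (if even (length lam + length \<mu>) then pfaffian (skew_mat lam \<mu>)
     else pfaffian (skew_mat (lam @ [0]) \<mu>))"

end

theory Submission imports Defs begin

text \<open>Since \<open>Q_pair r 0 = schur_q r\<close>, the column that \<mu> = (0) adjoins to a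
  matrix is, above the diagonal, the column of an extra part 0, and a Pfaffian depends only on
  entries above the diagonal (\<open>pfaffian_skew_mat_0\<close>). For odd n both sides are thus Pf
  M(\<lambda>0). For even n the left side is Pf M(\<lambda>00), whose last two columns agree in the
  first n rows; by \<open>pfaffian_equal_last_columns\<close> it is their mutual entry,
  \<open>Q_pair 0 0 = 1\<close>, times Pf M(\<lambda>).\<close>

lemma dim_pfaffian_minor:
  "dim_row (mat_delete (mat_delete A j j) 0 0) = dim_row A - 2"
  "dim_col (mat_delete (mat_delete A j j) 0 0) = dim_col A - 2"
  by (simp_all add: mat_delete_def)

lemma index_pfaffian_minor:
  assumes "a + 2 < dim_row A" "b + 2 < dim_col A"
  shows "mat_delete (mat_delete A j j) 0 0 $$ (a, b) =
    A $$ (insert_index j (Suc a), insert_index j (Suc b))"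
  using assms by (auto simp: mat_delete_def insert_index_def)

text \<open>The expansion uses row 0 right of the diagonal, and passing to a minor re-indexes by a
  strictly increasing map, so the recursion never leaves the upper triangle.\<close>

lemma pfaffian_cong_upper:
  assumes "dim_row A = n" "dim_col A = n" "dim_row B = n" "dim_col B = n"
    and "\<And>i j. i < j \<Longrightarrow> j < n \<Longrightarrow> A $$ (i, j) = B $$ (i, j)"
  shows "pfaffian A = pfaffian B"
  using assms
proof (induction n arbitrary: A B rule: less_induct)
  case (less n)
  show ?case
  proof (cases "n = 0")
    case True
    then show ?thesis
      using less.prems by (simp add: pfaffian.simps)
  next
    case False
    have "pfaffian (mat_delete (mat_delete A j j) 0 0) = pfaffian (mat_delete (mat_delete B j j) 0 0)"
      if "j \<in> {1..<n}" for j
    proof (rule less.IH[of "n - 2"])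
      fix a b assume "a < b" "b < n - 2"
      then show "mat_delete (mat_delete A j j) 0 0 $$ (a, b) = mat_delete (mat_delete B j j) 0 0 $$ (a, b)"
        using less.prems by (simp add: index_pfaffian_minor insert_index_def)
    qed (use False less.prems in \<open>simp_all add: dim_pfaffian_minor\<close>)
    then show ?thesis
      using False less.prems by (simp add: pfaffian.simps[of A] pfaffian.simps[of B])
  qed
qed

text \<open>In the expansion along row 0 the terms of the two equal columns cancel, and all other
  minors inherit the hypothesis.\<close>

lemma pfaffian_equal_last_columns:
  assumes "dim_row A = n + 2" "dim_col A = n + 2"
    and "dim_row B = n" "dim_col B = n"
    and "\<And>i j. i < j \<Longrightarrow> j < n \<Longrightarrow> B $$ (i, j) = A $$ (i, j)"
    and "\<And>i. i < n \<Longrightarrow> A $$ (i, n) = A $$ (i, Suc n)"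
  shows "pfaffian A = A $$ (n, Suc n) * pfaffian B"
  using assms
proof (induction n arbitrary: A B rule: less_induct)
  case (less n)
  note dims = less.prems(1-4)
  define minor where "minor C j = mat_delete (mat_delete C j j) 0 0" for C :: "'a mat" and j
  show ?case
  proof (cases "n = 0")
    case True
    have "pfaffian (minor A 1) = 1"
      using dims True by (simp add: pfaffian.simps minor_def dim_pfaffian_minor)
    moreover have "pfaffian B = 1"
      using dims True by (simp add: pfaffian.simps)
    ultimately show ?thesis
      using dims True by (simp add: pfaffian.simps[of A] minor_def)
  next
    case False
    have minor: "pfaffian (minor A j) = A $$ (n, Suc n) * pfaffian (minor B j)"
      if j: "j \<in> {1..<n}" for j
    proof -
      have n: "n - 2 < n"
        using j by auto
      \<comment> \<open>Deleting 0 and some j < n moves the two special columns to positions n - 2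
        and n - 1, where the induction hypothesis expects them.\<close>
      have last_index: "insert_index j (Suc (n - 2)) = n" "insert_index j (Suc (Suc (n - 2))) = Suc n"
        using j by (auto simp: insert_index_def)
      have "pfaffian (minor A j) = minor A j $$ (n - 2, Suc (n - 2)) * pfaffian (minor B j)"
      proof (rule less.IH[OF n])
        fix a b assume "a < b" "b < n - 2"
        then show "minor B j $$ (a, b) = minor A j $$ (a, b)"
          using dims less.prems(5) by (simp add: minor_def index_pfaffian_minor insert_index_def)
      next
        fix a assume "a < n - 2"
        then have "insert_index j (Suc a) < n"
          by (auto simp: insert_index_def)
        then show "minor A j $$ (a, n - 2) = minor A j $$ (a, Suc (n - 2))"
          using dims j last_index \<open>a < n - 2\<close> less.prems(6)
          by (simp add: minor_def index_pfaffian_minor)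
      qed (use dims j in \<open>auto simp: minor_def dim_pfaffian_minor\<close>)
      moreover have "minor A j $$ (n - 2, Suc (n - 2)) = A $$ (n, Suc n)"
        using dims j last_index by (auto simp: minor_def index_pfaffian_minor)
      ultimately show ?thesis
        by simp
    qed
    have last: "pfaffian (minor A n) = pfaffian (minor A (Suc n))"
    proof (rule pfaffian_cong_upper[of _ n])
      fix a b assume "a < b" "b < n"
      then show "minor A n $$ (a, b) = minor A (Suc n) $$ (a, b)"
        using dims less.prems(6)
        \<comment> \<open>These minors differ only in their last column, which comes from column n +
          1 of A in one and column n in the other.\<close>
        by (cases "Suc b = n") (auto simp: minor_def index_pfaffian_minor insert_index_def)
    qed (use dims in \<open>simp_all add: minor_def dim_pfaffian_minor\<close>)
    have "pfaffian A = (\<Sum>j\<in>{1..<n + 2}. (-1) ^ (j + 1) * A $$ (0, j) * pfaffian (minor A j))"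
      using dims by (simp add: pfaffian.simps[of A] minor_def)
    also have "\<dots> = (\<Sum>j\<in>{1..<n}. (-1) ^ (j + 1) * A $$ (0, j) * pfaffian (minor A j))"
      \<comment> \<open>The terms j = n and j = n + 1 have opposite signs and equal factors;
        equality of the entries in row 0 needs n > 0.\<close>
      using False less.prems(6)[of 0] last by simp
    also have "\<dots> = (\<Sum>j\<in>{1..<n}. A $$ (n, Suc n) * ((-1) ^ (j + 1) * B $$ (0, j) * pfaffian (minor B j)))"
      using less.prems(5) by (intro sum.cong) (auto simp: minor mult_ac)
    also have "\<dots> = A $$ (n, Suc n) * pfaffian B"
      using dims False by (simp add: pfaffian.simps[of B] minor_def sum_distrib_left)
    finally show ?thesis .
  qed
qed

lemma Q_pair_0_right: "Q_pair r 0 = schur_q r"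
  by (simp add: Q_pair_def schur_q_0)

lemma dim_Q_mat [simp]: "dim_row (Q_mat \<nu>) = length \<nu>" "dim_col (Q_mat \<nu>) = length \<nu>"
  by (simp_all add: Q_mat_def)

lemma pfaffian_skew_mat_0: "pfaffian (skew_mat lam [0]) = pfaffian (Q_mat (lam @ [0]))"
  by (rule pfaffian_cong_upper[of _ "Suc (length lam)"])
     (auto simp: skew_mat_def N_mat_def Q_mat_def nth_append Q_pair_0_right)

theorem corollary3p3:
  fixes lam :: "int list"
  shows "Q_skew lam [0] = Q_fun lam"
proof (cases "even (length lam)")
  case True
  \<comment> \<open>The inner 0 evens out the total length, the outer one is \<mu>. The bracketing
    matches \<open>pfaffian_skew_mat_0\<close> at \<open>lam @ [0]\<close>, hence
    \<open>del: append_assoc\<close> below.\<close>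
  let ?A = "Q_mat ((lam @ [0]) @ [0])" and ?n = "length lam"
  have "pfaffian ?A = ?A $$ (?n, Suc ?n) * pfaffian (Q_mat lam)"
    by (rule pfaffian_equal_last_columns) (auto simp: Q_mat_def nth_append)
  moreover have "?A $$ (?n, Suc ?n) = 1"
    by (simp add: Q_mat_def nth_append Q_pair_0_right schur_q_0)
  ultimately show ?thesis
    using True by (simp add: Q_skew_def Q_fun_def pfaffian_skew_mat_0 del: append_assoc)
next
  case False
  then show ?thesis
    by (simp add: Q_skew_def Q_fun_def pfaffian_skew_mat_0)
qed

end
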